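(* Let $n,m\ge2$ be integers and let $a_1,\dots,a_{n+m}$ be real numbers with $0\le a_i\le1$ for all $i$ and $a_n+a_{n+m}\le1$. Put $\bar a_i=1-a_i$ for $i\neq n,n+m$ and $\bar a_n=\bar a_{n+m}=1-a_n-a_{n+m}$. Then there exists a probability distribution $Q$ on the vector of initial differences $(q_j^0-q_1^0)_{j=2,\dots,n+m}\in\mathbb R^{n+m-1}$, namely a Kryloff–Bogoliuboff invariant measure of the junction dynamics (both defined in the context), such that for $Q$-almost every value of the initial differences the average flow $$\chi=\lim_{k\to\infty}\frac{q_i^k}{k}\qquad\text{for all } i\in\{1,\dots,n+m\}$$ exists, i.e. all these limits exist in $\mathbb R$ and have a common value $\chi$ (which may depend on the initial differences).
   Context: All formulas are in ordinary arithmetic. The junction dynamics (traffic on two circular roads crossing at one junction) is the recursion on $q^k=(q^k_1,\dots,q^k_{n+m})\in\mathbb R^{n+m}$, $k\in\mathbb N$, given by $$\begin{cases} q_i^{k+1}=\min\{a_{i-1}+q_{i-1}^k,\ \bar a_i+q_{i+1}^k\}, & i\in\{1,\dots,n+m\}\setminus\{1,n,n+1,n+m\},\\ q_n^{k+1}=\min\{\bar a_n+q_1^k+q_{n+1}^k-q_{n+m}^k,\ a_{n-1}+q_{n-1}^k\},\\ q_{n+m}^{k+1}=\min\{\bar a_{n+m}+q_1^k+q_{n+1}^k-q_n^{k+1},\ a_{n+m-1}+q_{n+m-1}^k\},\\ q_1^{k+1}=\min\{a_n+\tfrac12(q_n^k+q_{n+m}^k),\ \bar a_1+q_2^k\},\\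 q_{n+1}^{k+1}=\min\{a_{n+m}+\tfrac12(q_n^k+q_{n+m}^k),\ \bar a_{n+1}+q_{n+2}^k\}. \end{cases}$$ (The third line uses $q_n^{k+1}$, which is determined by the second line.) Write $q^{k+1}=f(q^k)$ for this recursion. Adding a constant to all components of $q^k$ adds the same constant to all components of $q^{k+1}$, so the vector of differences $y^k=(q_j^k-q_1^k)_{j=2,\dots,n+m}$ evolves autonomously: $y^{k+1}=g(y^k)$ with $g_{j-1}(y)=f_j(0,y)-f_1(0,y)$ for $j=2,\dots,n+m$; moreover the existence and value of $\lim_k q_i^k/k$ depend on $q^0$ only through $y^0$. A Kryloff–Bogoliuboff invariant measure is a $g$-invariant probability measure on $\mathbb R^{n+m-1}$ that is the weak limit, along some subsequence $N\to\infty$, of the empirical measures $$P^N_{y^0}=\frac1N\left(\delta_{y^0}+\delta_{g(y^0)}+\dots+\delta_{g^{N-1}(y^0)}\right),$$ where $\delta_a$ is the Dirac mass at $a$ and $y^0$ is a point with bounded orbit under $g$; here the starting point is $y^0=0$, corresponding to $q^0=0$. *)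

theory Defs
  imports "HOL-Probability.Probability"
begin

text \<open>
  For a finite index set \<open>I\<close>, the space \<open>\<real>\<^sup>I\<close> is the set \<open>I \<rightarrow>\<^sub>E UNIV\<close> of functions that are
  \<open>undefined\<close> outside \<open>I\<close>; this is both the underlying space of the Borel measurable space
  \<open>borel_RI I\<close> and of the product topology used in \<open>weakly_converges\<close>.
\<close>

definition borel_RI :: "nat set \<Rightarrow> (nat \<Rightarrow> real) measure"
  where "borel_RI I = PiM I (\<lambda>_. borel)"

definition weakly_converges ::
    "nat set \<Rightarrow> (nat \<Rightarrow> (nat \<Rightarrow> real) measure) \<Rightarrow> (nat \<Rightarrow> real) measure \<Rightarrow> bool"
  where "weakly_converges I M Q \<longleftrightarrow>
    (\<forall>\<phi> :: (nat \<Rightarrow> real) \<Rightarrow> real.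
       continuous_map (product_topology (\<lambda>_. euclideanreal) I) euclideanreal \<phi> \<and>
       bounded (\<phi> ` (I \<rightarrow>\<^sub>E UNIV)) \<longrightarrow>
       (\<lambda>k. integral\<^sup>L (M k) \<phi>) \<longlonglongrightarrow> integral\<^sup>L Q \<phi>)"

text \<open>
  The measure \<open>(\<delta>\<^bsub>y\<^esub> + \<delta>\<^bsub>g y\<^esub> + \<dots>) / N\<close> with \<open>N\<close> summands, as the image of
  the uniform distribution on \<open>{..<N}\<close>; it is the zero measure for \<open>N = 0\<close>.
\<close>

definition empirical_measure ::
    "nat set \<Rightarrow> ((nat \<Rightarrow> real) \<Rightarrow> nat \<Rightarrow> real) \<Rightarrow> (nat \<Rightarrow> real) \<Rightarrow> nat \<Rightarrow> (nat \<Rightarrow> real) measure"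
  where "empirical_measure I g y N =
    distr (uniform_count_measure {..<N}) (borel_RI I) (\<lambda>i. (g ^^ i) y)"

lemma measure_empirical_measure:
  assumes "\<And>i. (g ^^ i) y \<in> I \<rightarrow>\<^sub>E UNIV" and "A \<in> sets (borel_RI I)"
  shows "measure (empirical_measure I g y N) A = (\<Sum>i<N. indicator A ((g ^^ i) y)) / real N"
proof -
  have m: "(\<lambda>i. (g ^^ i) y) \<in> measurable (uniform_count_measure {..<N}) (borel_RI I)"
    using assms(1) by (auto simp: measurable_def borel_RI_def space_PiM
        space_uniform_count_measure sets_uniform_count_measure)
  have "measure (empirical_measure I g y N) A
      = measure (uniform_count_measure {..<N}) ((\<lambda>i. (g ^^ i) y) -` A \<inter> {..<N})"
    unfolding empirical_measure_def
    by (subst measure_distr[OF m assms(2)]) (simp add: space_uniform_count_measure)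
  also have "\<dots> = card ((\<lambda>i. (g ^^ i) y) -` A \<inter> {..<N}) / real N"
    by (subst measure_uniform_count_measure) auto
  also have "real (card ((\<lambda>i. (g ^^ i) y) -` A \<inter> {..<N})) = (\<Sum>i<N. indicator A ((g ^^ i) y))"
  proof -
    have "(\<Sum>i<N. indicator A ((g ^^ i) y) :: real)
        = (\<Sum>i<N. indicator ((\<lambda>i. (g ^^ i) y) -` A) i)"
      by (intro sum.cong) (auto simp: indicator_def)
    also have "\<dots> = card ({..<N} \<inter> (\<lambda>i. (g ^^ i) y) -` A)"
      by (simp add: indicator_def sum.If_cases Int_def)
    finally show ?thesis by (simp add: Int_commute)
  qed
  finally show ?thesis .
qed

definition bounded_orbit ::
    "nat set \<Rightarrow> ((nat \<Rightarrow> real) \<Rightarrow> nat \<Rightarrow> real) \<Rightarrow> (nat \<Rightarrow> real) \<Rightarrow> bool"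
  where "bounded_orbit I g y \<longleftrightarrow> (\<exists>B. \<forall>k. \<forall>j\<in>I. \<bar>(g ^^ k) y j\<bar> \<le> B)"

definition kryloff_bogoliuboff_measure ::
    "nat set \<Rightarrow> ((nat \<Rightarrow> real) \<Rightarrow> nat \<Rightarrow> real) \<Rightarrow> (nat \<Rightarrow> real) \<Rightarrow> (nat \<Rightarrow> real) measure \<Rightarrow> bool"
  where "kryloff_bogoliuboff_measure I g y Q \<longleftrightarrow>
    prob_space Q \<and> sets Q = sets (borel_RI I) \<and>
    g \<in> measurable Q Q \<and> distr Q Q g = Q \<and>
    y \<in> I \<rightarrow>\<^sub>E UNIV \<and> bounded_orbit I g y \<and>
    (\<exists>r :: nat \<Rightarrow> nat. strict_mono r \<and>
       weakly_converges I (\<lambda>k. empirical_measure I g y (r k)) Q)"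

definition abar :: "nat \<Rightarrow> nat \<Rightarrow> (nat \<Rightarrow> real) \<Rightarrow> nat \<Rightarrow> real"
  where "abar n m a i = (if i = n \<or> i = n + m then 1 - a n - a (n + m) else 1 - a i)"

text \<open>The new value of \<open>q\<^sub>n\<close>, which also enters the update of component \<open>n + m\<close>.\<close>

definition junction_n :: "nat \<Rightarrow> nat \<Rightarrow> (nat \<Rightarrow> real) \<Rightarrow> (nat \<Rightarrow> real) \<Rightarrow> real"
  where "junction_n n m a q =
    min (abar n m a n + q 1 + q (n + 1) - q (n + m)) (a (n - 1) + q (n - 1))"

definition junction_map ::
    "nat \<Rightarrow> nat \<Rightarrow> (nat \<Rightarrow> real) \<Rightarrow> (nat \<Rightarrow> real) \<Rightarrow> (nat \<Rightarrow> real)"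
  where "junction_map n m a q = (\<lambda>i\<in>{1..n + m}.
    if i = n then junction_n n m a q
    else if i = n + m then
      min (abar n m a (n + m) + q 1 + q (n + 1) - junction_n n m a q)
          (a (n + m - 1) + q (n + m - 1))
    else if i = 1 then
      min (a n + 1 / 2 * (q n + q (n + m))) (abar n m a 1 + q 2)
    else if i = n + 1 then
      min (a (n + m) + 1 / 2 * (q n + q (n + m))) (abar n m a (n + 1) + q (n + 2))
    else
      min (a (i - 1) + q (i - 1)) (abar n m a i + q (i + 1)))"

text \<open>
  The differences keep their original indices, so \<open>\<real>\<^bsup>n+m-1\<^esup>\<close> is \<open>\<real>\<^sup>I\<close> for \<open>I = {2..n + m}\<close>.
\<close>

definition differences :: "nat \<Rightarrow> nat \<Rightarrow> (nat \<Rightarrow> real) \<Rightarrow> (nat \<Rightarrow> real)"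
  where "differences n m q = (\<lambda>j\<in>{2..n + m}. q j - q 1)"

definition difference_map ::
    "nat \<Rightarrow> nat \<Rightarrow> (nat \<Rightarrow> real) \<Rightarrow> (nat \<Rightarrow> real) \<Rightarrow> (nat \<Rightarrow> real)"
  where "difference_map n m a y = differences n m (junction_map n m a (y(1 := 0)))"

end

theory Submission
  imports Defs
begin

text \<open>
  Along the orbit of \<open>q = 0\<close> the components never decrease. Hence \<open>q i \<le> f q i\<close>, and the two arguments
  of each minimum bound neighbouring components on a road by each other up to \<open>1\<close>; the averaging at the
  entries links the two roads. So the differences stay bounded, and the empirical measures of the
  difference orbit have a weak limit, which is invariant because the map is continuous. The
  increment of \<open>q 1\<close> is a bounded continuous function of the differences, so Birkhoff's ergodic theorem
  gives the mean growth of \<open>q 1\<close> almost surely; the other components stay at bounded distance from \<open>q 1\<close>.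
\<close>

section \<open>Schoenberg's space-filling curve\<close>

text \<open>Boundedness is established only along increasing orbits such as that of zero; other
  initial differences get no direct bound. They are reached through the measure: \<open>Q\<close> is
  carried by the box, and invariance puts almost every whole orbit inside it. As \<open>Q\<close> is
  not shown to be ergodic, the limit from Birkhoff's theorem may vary with the starting point, so
  the flow is attached to the vector of differences.

  The second obstacle is compactness of probability measures on a box in several dimensions. A
  continuous curve from \<open>{0..1}\<close> onto the box reduces it to one dimension: orbit points
  are lifted to parameters, a weak limit of the lifted empirical measures is taken on the line, and
  the curve pushes it forward, which preserves weak convergence. The curve has a coordinate for
  every natural number, so one construction serves all finite index sets.\<close>

definition ternary :: "(nat \<Rightarrow> bool) \<Rightarrow> real"
  where "ternary c = (\<Sum>k. 2 * of_bool (c k) / 3 ^ Suc k)"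

lemma third_powers_sums: "(\<lambda>k. 2 / 3 ^ Suc k :: real) sums 1"
  using sums_mult[OF geometric_sums[of "1 / 3 :: real"], of "2 / 3"]
  by (simp add: power_divide)

lemma summable_ternary: "summable (\<lambda>k. 2 * of_bool (c k) / 3 ^ Suc k :: real)"
  by (rule summable_comparison_test'[OF sums_summable[OF third_powers_sums], of 0]) auto

lemma ternary_bounds: "ternary c \<in> {0..1}"
proof -
  have "ternary c \<le> (\<Sum>k. 2 / 3 ^ Suc k)"
    unfolding ternary_def
    by (rule suminf_le[OF _ summable_ternary sums_summable[OF third_powers_sums]]) auto
  then have "ternary c \<le> 1"
    using sums_unique[OF third_powers_sums] by simp
  moreover have "0 \<le> ternary c"
    unfolding ternary_def by (rule suminf_nonneg[OF summable_ternary]) auto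
  ultimately show ?thesis by simp
qed

text \<open>Points \<open>ternary c\<close> form the Cantor set, and tripling shifts their digits.
  The digit pushed out is 0 or 2, an even integer, hence invisible to functions of period 2 such as
  \<open>cos (pi * t)\<close>.\<close>

lemma ternary_shift: "3 * ternary c = 2 * of_bool (c 0) + ternary (\<lambda>k. c (Suc k))"
proof -
  have "(\<Sum>k. 2 * of_bool (c (Suc k)) / 3 ^ Suc (Suc k)) = ternary c - 2 * of_bool (c 0) / 3"
    unfolding ternary_def by (subst suminf_split_head[OF summable_ternary]) simp
  moreover have "(\<Sum>k. 2 * of_bool (c (Suc k)) / 3 ^ Suc (Suc k)) = ternary (\<lambda>k. c (Suc k)) / 3"
    unfolding ternary_def
    by (subst suminf_divide[OF summable_ternary, symmetric]) (simp add: field_simps)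
  ultimately show ?thesis by simp
qed

lemma cos_ternary: "cos (pi * (3 ^ k * ternary c)) = cos (pi * ternary (\<lambda>i. c (i + k)))"
proof (induction k arbitrary: c)
  case (Suc k)
  have "pi * (3 ^ Suc k * ternary c) = pi * (3 ^ k * (3 * ternary c))"
    by simp
  also have "\<dots> = pi * (3 ^ k * ternary (\<lambda>i. c (Suc i))) + 2 * of_nat (3 ^ k * of_bool (c 0)) * pi"
    unfolding ternary_shift by (simp add: algebra_simps)
  finally have "cos (pi * (3 ^ Suc k * ternary c)) = cos (pi * (3 ^ k * ternary (\<lambda>i. c (Suc i))))"
    by (simp only: cos_add cos_2npi sin_2npi)
  then show ?case
    using Suc.IH[of "\<lambda>i. c (Suc i)"] by simp
qed simp

text \<open>
  For \<open>t = ternary c\<close> the fractional part of \<open>3 ^ k * t / 2\<close> lies in the first sixth of the period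
  or between its third and its half, according to \<open>c k\<close>; by clamping the cosine, \<open>bump\<close> takes
  the values \<open>0\<close> and \<open>1\<close> there and thus reads off single digits continuously.
\<close>

definition bump :: "real \<Rightarrow> real"
  where "bump t = max 0 (min 1 (1 / 2 - cos (pi * t)))"

lemma bump_bounds: "0 \<le> bump t" "bump t \<le> 1"
  by (auto simp: bump_def)

lemma bump_ternary: "bump (3 ^ k * ternary c) = of_bool (c k)"
proof -
  define d where "d = (\<lambda>i. c (i + k))"
  have *: "3 * ternary d = 2 * of_bool (c k) + ternary (\<lambda>i. d (Suc i))"
    by (simp add: ternary_shift d_def)
  have b: "0 \<le> ternary (\<lambda>i. d (Suc i))" "ternary (\<lambda>i. d (Suc i)) \<le> 1"
    using ternary_bounds[of "\<lambda>i. d (Suc i)"] by auto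
  have "bump (3 ^ k * ternary c) = bump (ternary d)"
    by (simp add: bump_def cos_ternary d_def)
  also have "\<dots> = of_bool (c k)"
  proof (cases "c k")
    case True
    then have "2 / 3 \<le> ternary d" "ternary d \<le> 1"
      using * b by auto
    then have "cos (pi * ternary d) \<le> cos (pi * (2 / 3))"
      by (intro cos_monotone_0_pi_le) auto
    moreover have "cos (pi * (2 / 3)) = - (1 / 2)"
      using cos_120 by (simp add: mult.commute)
    ultimately show ?thesis
      using True by (simp add: bump_def)
  next
    case False
    then have "0 \<le> ternary d" "ternary d \<le> 1 / 3"
      using * b by auto
    then have "cos (pi * (1 / 3)) \<le> cos (pi * ternary d)"
      by (intro cos_monotone_0_pi_le) auto
    moreover have "cos (pi * (1 / 3)) = 1 / 2"
      using cos_60 by simp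
    ultimately show ?thesis
      using False by (simp add: bump_def)
  qed
  finally show ?thesis .
qed

text \<open>Greedy digits: \<open>u k\<close> is the remainder after \<open>k\<close> digits,
  magnified by \<open>2 ^ k\<close>. It stays in \<open>{0..1}\<close>, which forces the partial
  sums to converge to \<open>x\<close>. The value 1 is a fixed point of the step, so
  \<open>x = 1\<close> receives the digit 1 throughout.\<close>

lemma binary_expansion:
  fixes x :: real
  assumes "x \<in> {0..1}"
  shows "\<exists>c :: nat \<Rightarrow> bool. (\<lambda>k. of_bool (c k) / 2 ^ Suc k) sums x"
proof -
  define u where "u = rec_nat x (\<lambda>_ u. 2 * u - of_bool (1 / 2 \<le> u))"
  have u0: "u 0 = x" and uS: "u (Suc k) = 2 * u k - of_bool (1 / 2 \<le> u k)" for k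
    by (simp_all add: u_def)
  have u: "u k \<in> {0..1}" for k
    by (induction k) (use assms in \<open>auto simp: u0 uS\<close>)
  have part: "(\<Sum>i<k. of_bool (1 / 2 \<le> u i) / 2 ^ Suc i) = x - u k / 2 ^ k" for k
    by (induction k) (auto simp: u0 uS field_simps)
  have "(\<lambda>k. u k / 2 ^ k) \<longlonglongrightarrow> 0"
  proof (rule tendsto_sandwich[OF _ _ tendsto_const])
    show "(\<lambda>k. (1 / 2) ^ k :: real) \<longlonglongrightarrow> 0"
      by (rule LIMSEQ_power_zero) simp
    show "\<forall>\<^sub>F k in sequentially. u k / 2 ^ k \<le> (1 / 2) ^ k"
      using u by (auto simp: power_divide divide_right_mono)
    show "\<forall>\<^sub>F k in sequentially. 0 \<le> u k / 2 ^ k"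
      using u by auto
  qed
  then have "(\<lambda>k. of_bool (1 / 2 \<le> u k) / 2 ^ Suc k) sums x"
    unfolding sums_def part using tendsto_diff[OF tendsto_const, of _ 0 _ x] by auto
  then show ?thesis by (intro exI)
qed

lemma half_powers_sums: "(\<lambda>k. 1 / 2 ^ Suc k :: real) sums 1"
  using power_half_series by (simp add: power_divide)

text \<open>The pairing \<open>prod_encode\<close> reserves infinitely many ternary positions for
  each coordinate \<open>j\<close>; on the Cantor set, \<open>bump\<close> reads these digits and
  the series reassembles them as a binary number.\<close>

definition schoenberg_curve :: "nat \<Rightarrow> real \<Rightarrow> real"
  where "schoenberg_curve j t = (\<Sum>k. bump (3 ^ prod_encode (j, k) * t) / 2 ^ Suc k)"

lemma continuous_on_schoenberg_curve: "continuous_on UNIV (schoenberg_curve j)"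
proof -
  have "uniform_limit UNIV (\<lambda>n t. \<Sum>k<n. bump (3 ^ prod_encode (j, k) * t) / 2 ^ Suc k)
      (schoenberg_curve j) sequentially"
    unfolding schoenberg_curve_def [abs_def]
    by (rule Weierstrass_m_test[OF _ sums_summable[OF half_powers_sums]])
       (auto simp: bump_bounds divide_right_mono)
  then show ?thesis
    by (rule uniform_limit_theorem[rotated])
       (auto simp: bump_def intro!: always_eventually continuous_intros)
qed

lemma schoenberg_curve_bounds: "schoenberg_curve j t \<in> {0..1}"
proof -
  let ?f = "\<lambda>k. bump (3 ^ prod_encode (j, k) * t) / 2 ^ Suc k"
  have s: "summable ?f"
    by (rule summable_comparison_test'[OF sums_summable[OF half_powers_sums], of 0])
       (auto simp: bump_bounds divide_right_mono)
  have "suminf ?f \<le> (\<Sum>k. 1 / 2 ^ Suc k)"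
    by (rule suminf_le[OF _ s sums_summable[OF half_powers_sums]])
       (auto simp: bump_bounds divide_right_mono)
  then have "suminf ?f \<le> 1"
    using sums_unique[OF half_powers_sums] by simp
  moreover have "0 \<le> suminf ?f"
    by (rule suminf_nonneg[OF s]) (auto simp: bump_bounds)
  ultimately show ?thesis
    by (simp add: schoenberg_curve_def)
qed

text \<open>The Cantor set alone is already mapped onto the cube: binary expansions of all
  coordinates are interleaved by \<open>prod_decode\<close> into the digits of a single
  parameter.\<close>

lemma schoenberg_curve_surj:
  assumes "\<And>j. x j \<in> {0..1}"
  shows "\<exists>t\<in>{0..1}. \<forall>j. schoenberg_curve j t = x j"
proof -
  obtain c where c: "(\<lambda>k. of_bool (c j k) / 2 ^ Suc k) sums x j" for j
    using binary_expansion[OF assms] by metis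
  define b where "b i = (case prod_decode i of (j, k) \<Rightarrow> c j k)" for i
  have "schoenberg_curve j (ternary b) = x j" for j
    unfolding schoenberg_curve_def bump_ternary
    using sums_unique[OF c[of j]] by (simp add: b_def)
  then show ?thesis
    using ternary_bounds[of b] by blast
qed

section \<open>Measures on finite powers of the reals\<close>

lemma space_borel_RI: "space (borel_RI I) = I \<rightarrow>\<^sub>E UNIV"
  by (simp add: borel_RI_def space_PiM)

lemma measurable_borel_RI_component: "j \<in> I \<Longrightarrow> (\<lambda>y. y j) \<in> borel_measurable (borel_RI I)"
  unfolding borel_RI_def by (rule measurable_component_singleton)

text \<open>The topology and the sigma-algebra on extensional functions meet in the full space
  \<open>nat \<Rightarrow> real\<close>, where Borel measurability can be checked coordinatewise.
  The map \<open>e\<close> extends by 0 outside \<open>I\<close>, and \<open>restrict\<close> undoes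
  this.\<close>

lemma continuous_imp_borel_RI_measurable:
  assumes "continuous_map (product_topology (\<lambda>_. euclideanreal) I) euclideanreal \<phi>"
  shows "\<phi> \<in> borel_measurable (borel_RI I)"
proof -
  define e :: "(nat \<Rightarrow> real) \<Rightarrow> nat \<Rightarrow> real" where "e y i = (if i \<in> I then y i else 0)" for y i
  have "continuous_map (product_topology (\<lambda>_. euclideanreal) UNIV) (product_topology (\<lambda>_. euclideanreal) I)
      (\<lambda>z. restrict z I)"
    unfolding continuous_map_componentwise
    by (auto intro: continuous_map_product_projection)
  from continuous_map_compose[OF this assms]
  have "continuous_on UNIV (\<lambda>z. \<phi> (restrict z I))"
    by (simp add: euclidean_product_topology o_def)
  then have "(\<lambda>z. \<phi> (restrict z I)) \<in> borel_measurable borel"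
    by (rule borel_measurable_continuous_onI)
  moreover have "e \<in> borel_measurable (borel_RI I)"
  proof (rule measurable_coordinatewise_then_product)
    show "(\<lambda>y. e y i) \<in> borel_measurable (borel_RI I)" for i
      by (cases "i \<in> I") (auto simp: e_def intro: measurable_borel_RI_component)
  qed
  ultimately have "(\<lambda>y. \<phi> (restrict (e y) I)) \<in> borel_measurable (borel_RI I)"
    by (rule measurable_compose[rotated])
  also have "?this \<longleftrightarrow> ?thesis"
    by (rule measurable_cong)
       (auto simp: e_def space_borel_RI restrict_def PiE_def extensional_def intro!: arg_cong[of _ _ \<phi>])
  finally show ?thesis .
qed

lemma continuous_imp_borel_RI_measurable_map:
  assumes "continuous_map (product_topology (\<lambda>_. euclideanreal) I)
      (product_topology (\<lambda>_. euclideanreal) I) g"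
  shows "g \<in> measurable (borel_RI I) (borel_RI I)"
proof -
  have "g y \<in> I \<rightarrow>\<^sub>E UNIV" if "y \<in> I \<rightarrow>\<^sub>E UNIV" for y
    using continuous_map_image_subset_topspace[OF assms] that by auto
  moreover have "(\<lambda>y. g y j) \<in> borel_measurable (borel_RI I)" if "j \<in> I" for j
    using assms that by (intro continuous_imp_borel_RI_measurable) auto
  ultimately show ?thesis
    unfolding borel_RI_def [where I = I]
    by (intro measurable_PiM_single') (auto simp: borel_RI_def space_PiM)
qed

text \<open>Lower orthants are a convenient generator: they are closed under intersection, and their
  indicators are pointwise limits of continuous functions.\<close>

lemma sets_borel_RI_atMost:
  assumes "finite I"
  shows "sets (borel_RI I) = sigma_sets (I \<rightarrow>\<^sub>E UNIV) {Pi\<^sub>E I (\<lambda>j. {..x j}) | x. True}"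
proof -
  let ?E = "range (\<lambda>a. {..a :: real})"
  have "sets (borel_RI I) = sets (\<Pi>\<^sub>M i\<in>I. sigma UNIV ?E)"
    unfolding borel_RI_def by (intro sets_PiM_cong refl) (simp add: borel_eq_atMost[symmetric])
  also have "\<dots> = sets (sigma (I \<rightarrow>\<^sub>E UNIV)
      {{f \<in> I \<rightarrow>\<^sub>E UNIV. \<forall>i\<in>j. f i \<in> A i} | A j. j \<in> {I} \<and> A \<in> Pi j (\<lambda>_. ?E)})"
  proof (rule sets_PiM_sigma)
    have "UNIV = \<Union> (range (\<lambda>n. {..real n}))"
      using real_arch_simple by auto
    then show "\<exists>S\<subseteq>?E. countable S \<and> (UNIV :: real set) = \<Union> S"
      by (intro exI[of _ "range (\<lambda>n. {..real n})"]) auto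
  qed (use assms in auto)
  also have "{{f \<in> I \<rightarrow>\<^sub>E UNIV. \<forall>i\<in>j. f i \<in> A i} | A j. j \<in> {I} \<and> A \<in> Pi j (\<lambda>_. ?E)}
      = {Pi\<^sub>E I (\<lambda>j. {..x j}) | x. True}" (is "?L = ?R")
  proof (intro set_eqI iffI)
    fix X assume "X \<in> ?L"
    then obtain A where X: "X = {f \<in> I \<rightarrow>\<^sub>E UNIV. \<forall>i\<in>I. f i \<in> A i}" and A: "A \<in> Pi I (\<lambda>_. ?E)"
      by auto
    then have "\<forall>i\<in>I. \<exists>x. A i = {..x}" by auto
    then obtain x where "\<And>i. i \<in> I \<Longrightarrow> A i = {..x i}" by metis
    then have "X = Pi\<^sub>E I (\<lambda>j. {..x j})" by (auto simp: X PiE_def Pi_def)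
    then show "X \<in> ?R" by blast
  next
    fix X assume "X \<in> ?R"
    then obtain x where "X = Pi\<^sub>E I (\<lambda>j. {..x j})" by auto
    then have "X = {f \<in> I \<rightarrow>\<^sub>E UNIV. \<forall>i\<in>I. f i \<in> {..x i}}"
      by (auto simp: PiE_def Pi_def)
    then show "X \<in> ?L" by (intro CollectI exI[of _ "\<lambda>i. {..x i}"] exI[of _ I]) auto
  qed
  finally show ?thesis
    by (subst (asm) sets_measure_of) auto
qed

text \<open>Uniqueness of weak limits: integrals of continuous functions determine the measure of
  every lower orthant by dominated convergence, and orthants form a generating system stable under
  intersection.\<close>

lemma measure_eqI_continuous:
  assumes I: "finite I"
    and M: "prob_space M" "sets M = sets (borel_RI I)"
    and N: "prob_space N" "sets N = sets (borel_RI I)"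
    and eq: "\<And>\<phi>. continuous_map (product_topology (\<lambda>_. euclideanreal) I) euclideanreal \<phi> \<Longrightarrow>
      bounded (\<phi> ` (I \<rightarrow>\<^sub>E UNIV)) \<Longrightarrow> integral\<^sup>L M \<phi> = integral\<^sup>L N \<phi>"
  shows "M = N"
proof (rule measure_eqI_generator_eq)
  interpret M: prob_space M by fact
  interpret N: prob_space N by fact
  let ?E = "{Pi\<^sub>E I (\<lambda>j. {..x j :: real}) | x. True}"
  show "Int_stable ?E"
  proof (rule Int_stableI)
    fix a b assume "a \<in> ?E" "b \<in> ?E"
    then obtain x y where "a = Pi\<^sub>E I (\<lambda>j. {..x j})" "b = Pi\<^sub>E I (\<lambda>j. {..y j})" by blast
    then have "a \<inter> b = Pi\<^sub>E I (\<lambda>j. {..min (x j) (y j)})"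
      by (auto simp: PiE_def Pi_def)
    then show "a \<inter> b \<in> ?E"
      by (intro CollectI exI[of _ "\<lambda>j. min (x j) (y j)"] conjI TrueI)
  qed
  show "?E \<subseteq> Pow (I \<rightarrow>\<^sub>E UNIV)" by auto
  show "sets M = sigma_sets (I \<rightarrow>\<^sub>E UNIV) ?E" "sets N = sigma_sets (I \<rightarrow>\<^sub>E UNIV) ?E"
    using M(2) N(2) sets_borel_RI_atMost[OF I] by simp_all
  show "range (\<lambda>n::nat. Pi\<^sub>E I (\<lambda>j. {..real n})) \<subseteq> ?E"
  proof (rule image_subsetI)
    show "Pi\<^sub>E I (\<lambda>j. {..real n}) \<in> ?E" for n :: nat
      by (intro CollectI exI[of _ "\<lambda>_. real n"] conjI refl TrueI)
  qed
  show "(\<Union>n. Pi\<^sub>E I (\<lambda>j. {..real n})) = I \<rightarrow>\<^sub>E UNIV"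
  proof (intro equalityI subsetI)
    fix y :: "nat \<Rightarrow> real" assume y: "y \<in> I \<rightarrow>\<^sub>E UNIV"
    obtain n where n: "Max (insert 0 (y ` I)) \<le> real n"
      using real_arch_simple by blast
    have "y j \<le> real n" if "j \<in> I" for j
      using n I that by (auto simp: Max_le_iff)
    with y show "y \<in> (\<Union>n. Pi\<^sub>E I (\<lambda>j. {..real n}))"
      by (auto simp: PiE_def Pi_def)
  qed auto
  show "emeasure M (Pi\<^sub>E I (\<lambda>j. {..real n})) \<noteq> \<infinity>" for n :: nat
    by simp
  fix X assume "X \<in> ?E"
  then obtain x where X: "X = Pi\<^sub>E I (\<lambda>j. {..x j})" by blast
  \<comment> \<open>Each factor is 1 up to \<open>x j\<close> and then falls with slope
    \<open>k\<close>, vanishing from \<open>x j + 1 / k\<close> on; as \<open>k\<close> grows the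
    product tends to the indicator of the orthant.\<close>
  define \<phi> where "\<phi> k y = (\<Prod>j\<in>I. max 0 (1 - real k * max 0 (y j - x j)))" for k :: nat and y
  have cont: "continuous_map (product_topology (\<lambda>_. euclideanreal) I) euclideanreal (\<phi> k)" for k
    unfolding \<phi>_def continuous_map_atin
    by (auto intro!: tendsto_intros simp: continuous_map_atin[symmetric]
        dest: continuous_map_product_projection[of _ I "\<lambda>_. euclideanreal", unfolded continuous_map_atin])
  have bound: "0 \<le> \<phi> k y" "\<phi> k y \<le> 1" for k y
    unfolding \<phi>_def by (auto intro!: prod_nonneg prod_le_1)
  have bdd: "bounded (\<phi> k ` (I \<rightarrow>\<^sub>E UNIV))" for k
    by (rule boundedI[of _ 1]) (auto simp: bound abs_le_iff intro: order_trans[OF _ bound(1)])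
  have lim: "(\<lambda>k. \<phi> k y) \<longlonglongrightarrow> indicator X y" if "y \<in> I \<rightarrow>\<^sub>E UNIV" for y
  proof (cases "y \<in> X")
    case True
    then have "\<phi> k y = 1" for k
      unfolding \<phi>_def X by (intro prod.neutral) (auto simp: PiE_def Pi_def max_def)
    with True show ?thesis by simp
  next
    case False
    with that obtain j where j: "j \<in> I" "x j < y j"
      by (auto simp: X PiE_def Pi_def)
    obtain n where n: "1 < real n * (y j - x j)"
      using reals_Archimedean3[of "y j - x j"] j by auto
    have "\<phi> k y = 0" if "k \<ge> n" for k
    proof -
      have "real n * (y j - x j) \<le> real k * (y j - x j)"
        using that j by (intro mult_right_mono) auto
      then have "1 < real k * (y j - x j)"
        using n by linarith
      then have "max 0 (1 - real k * max 0 (y j - x j)) = 0"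
        using j by (simp add: max_def)
      then show ?thesis
        unfolding \<phi>_def using j(1) by (intro prod_zero[OF I] bexI[of _ j])
    qed
    with False show ?thesis
      by (intro tendsto_eventually) (auto simp: eventually_sequentially)
  qed
  have X_sets: "X \<in> sets (borel_RI I)"
    unfolding sets_borel_RI_atMost[OF I] X by (intro sigma_sets.Basic) blast
  have conv: "(\<lambda>k. integral\<^sup>L P (\<phi> k)) \<longlonglongrightarrow> measure P X"
    if P: "prob_space P" "sets P = sets (borel_RI I)" for P
  proof -
    interpret P: prob_space P by fact
    have "(\<lambda>k. integral\<^sup>L P (\<phi> k)) \<longlonglongrightarrow> integral\<^sup>L P (indicator X)"
    proof (rule integral_dominated_convergence[where w = "\<lambda>_. 1"])
      show "indicator X \<in> borel_measurable P"
        using X_sets P(2) by (intro borel_measurable_indicator) auto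
      show "\<phi> k \<in> borel_measurable P" for k
        using continuous_imp_borel_RI_measurable[OF cont] P(2) by (simp cong: measurable_cong_sets)
      show "AE y in P. (\<lambda>k. \<phi> k y) \<longlonglongrightarrow> indicator X y"
        using lim by (intro AE_I2) (simp add: sets_eq_imp_space_eq[OF P(2)] space_borel_RI)
      show "AE y in P. norm (\<phi> k y) \<le> 1" for k
        using bound by simp
    qed simp
    then show ?thesis
      using X_sets P(2) by simp
  qed
  have "measure M X = measure N X"
    using LIMSEQ_unique[OF conv[OF M]] conv[OF N] eq[OF cont bdd] by simp
  then show "emeasure M X = emeasure N X"
    by (simp add: M.emeasure_eq_measure N.emeasure_eq_measure)
qed

section \<open>The Krylov--Bogoliubov construction\<close>

lemma integral_empirical_measure:
  assumes "\<And>i. (g ^^ i) y \<in> I \<rightarrow>\<^sub>E UNIV" and "\<phi> \<in> borel_measurable (borel_RI I)"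
  shows "integral\<^sup>L (empirical_measure I g y N) \<phi> = (\<Sum>i<N. \<phi> ((g ^^ i) y)) / real N"
proof -
  have "(\<lambda>i. (g ^^ i) y) \<in> measurable (uniform_count_measure {..<N}) (borel_RI I)"
    using assms(1) by (auto simp: measurable_def space_borel_RI
        space_uniform_count_measure sets_uniform_count_measure)
  then show ?thesis
    unfolding empirical_measure_def
    by (subst integral_distr) (auto simp: assms(2) integral_uniform_count_measure)
qed

text \<open>Invariance holds in the limit because the integrals of \<open>\<phi> \<circ> g\<close>
  and \<open>\<phi>\<close> against the empirical measure telescope to two boundary terms divided by
  \<open>N\<close>; continuity of \<open>g\<close> makes \<open>\<phi> \<circ> g\<close> an
  admissible test function. The bound on \<open>Q\<close> holds because \<open>Q\<close> is an image
  under the curve \<open>p\<close>, which never leaves the box.\<close>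

lemma krylov_bogoliubov:
  assumes I: "finite I"
    and g: "continuous_map (product_topology (\<lambda>_. euclideanreal) I)
      (product_topology (\<lambda>_. euclideanreal) I) g"
    and y: "y \<in> I \<rightarrow>\<^sub>E UNIV"
    and B: "B > 0" "\<And>k j. j \<in> I \<Longrightarrow> \<bar>(g ^^ k) y j\<bar> \<le> B"
  shows "\<exists>Q. kryloff_bogoliuboff_measure I g y Q \<and> (AE z in Q. \<forall>j\<in>I. \<bar>z j\<bar> \<le> B)"
proof -
  let ?X = "product_topology (\<lambda>_. euclideanreal) I"
  have g_meas: "g \<in> measurable (borel_RI I) (borel_RI I)"
    by (rule continuous_imp_borel_RI_measurable_map[OF g])
  have orbit: "(g ^^ k) y \<in> I \<rightarrow>\<^sub>E UNIV" for k
    by (induction k) (use y measurable_space[OF g_meas] in \<open>auto simp: space_borel_RI\<close>)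
  \<comment> \<open>Helly's selection theorem concerns the real line; the curve \<open>p\<close> fills the box containing
    the orbit, so that the empirical measures are images of measures on \<open>{0..1}\<close>.\<close>
  define p where "p t = (\<lambda>j\<in>I. B * (2 * schoenberg_curve j t - 1))" for t
  have p_cont: "continuous_map euclideanreal ?X p"
    unfolding continuous_map_componentwise
    by (auto simp: p_def intro!: continuous_intros continuous_on_schoenberg_curve)
  have p_meas: "p \<in> measurable borel (borel_RI I)"
    unfolding borel_RI_def p_def
    by (intro measurable_restrict borel_measurable_continuous_onI continuous_intros
        continuous_on_schoenberg_curve)
  have p_bound: "\<bar>p t j\<bar> \<le> B" if "j \<in> I" for t j
  proof -
    have "\<bar>2 * schoenberg_curve j t - 1\<bar> \<le> 1"
      using schoenberg_curve_bounds[of j t] by auto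
    then have "\<bar>B\<bar> * \<bar>2 * schoenberg_curve j t - 1\<bar> \<le> \<bar>B\<bar> * 1"
      by (rule mult_left_mono) simp
    then show ?thesis using that B(1) by (simp add: p_def abs_mult)
  qed
  have "\<exists>t\<in>{0..1}. p t = (g ^^ i) y" for i
  proof -
    \<comment> \<open>Affine rescaling from the interval between \<open>- B\<close> and
      \<open>B\<close> to \<open>{0..1}\<close>. Surjectivity of the curve asks for a target at
      every natural number, so coordinates outside \<open>I\<close> get the value 0.\<close>
    define x where "x j = (if j \<in> I then ((g ^^ i) y j / B + 1) / 2 else 0)" for j
    have "x j \<in> {0..1}" for j
      using B(2)[of j i] B(1) by (auto simp: x_def abs_le_iff field_simps)
    then obtain t where t: "t \<in> {0..1}" "\<And>j. schoenberg_curve j t = x j"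
      using schoenberg_curve_surj[of x] by blast
    have "p t = (g ^^ i) y"
    proof
      fix j show "p t j = (g ^^ i) y j"
        using orbit[of i] B(1) by (cases "j \<in> I") (auto simp: p_def t(2) x_def PiE_def extensional_def field_simps)
    qed
    with t(1) show ?thesis by blast
  qed
  then obtain t where t: "\<And>i. t i \<in> {0..1}" "\<And>i. p (t i) = (g ^^ i) y"
    by metis
  \<comment> \<open>Starting from one sample avoids the zero measure at \<open>N = 0\<close>; hence
    the final subsequence is \<open>Suc (r k)\<close>.\<close>
  define \<nu> where "\<nu> k = distr (uniform_count_measure {..<Suc k}) borel t" for k
  have t_meas: "t \<in> measurable (uniform_count_measure {..<Suc k}) borel" for k
    by (auto simp: measurable_def space_uniform_count_measure sets_uniform_count_measure)
  have prob_count: "prob_space (uniform_count_measure {..<Suc k})" for k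
    by (rule prob_space_uniform_count_measure) auto
  have \<nu>_dist: "real_distribution (\<nu> k)" for k
    unfolding \<nu>_def by (rule prob_space.real_distribution_distr[OF prob_count t_meas])
  have emp: "empirical_measure I g y (Suc k) = distr (\<nu> k) (borel_RI I) p" for k
    unfolding empirical_measure_def \<nu>_def distr_distr[OF p_meas t_meas]
    by (simp add: o_def t(2))
  have "tight \<nu>"
    unfolding tight_def
  proof (intro conjI allI impI)
    fix \<epsilon> :: real assume "\<epsilon> > 0"
    \<comment> \<open>Tightness is phrased with intervals open on the left; the left end -1 keeps
      the parameter 0 inside.\<close>
    have "measure (\<nu> k) {-1<..1} = 1" for k
    proof -
      interpret prob_space "uniform_count_measure {..<Suc k}" by (rule prob_count)
      have "t i \<in> {-1<..1}" for i
        using t(1)[of i] by auto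
      then have "t -` {-1<..1} \<inter> space (uniform_count_measure {..<Suc k})
          = space (uniform_count_measure {..<Suc k})"
        by auto
      then show ?thesis
        unfolding \<nu>_def by (subst measure_distr[OF t_meas]) (auto simp: prob_space)
    qed
    with \<open>\<epsilon> > 0\<close> show "\<exists>a b. a < b \<and> (\<forall>n. 1 - \<epsilon> < measure (\<nu> n) {a<..b})"
      by (intro exI[of _ "-1"] exI[of _ 1]) auto
  qed (rule \<nu>_dist)
  from tight_imp_convergent_subsubsequence[OF this strict_mono_id]
  obtain r \<mu> where r: "strict_mono r" and \<mu>: "real_distribution \<mu>" "weak_conv_m (\<nu> \<circ> r) \<mu>"
    by auto
  interpret \<mu>: real_distribution \<mu> by fact
  have p_meas_\<mu>: "p \<in> measurable \<mu> (borel_RI I)"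
    using p_meas by (simp cong: measurable_cong_sets)
  define Q where "Q = distr \<mu> (borel_RI I) p"
  have Q_sets: "sets Q = sets (borel_RI I)" and Q_prob: "prob_space Q"
    unfolding Q_def by (simp_all add: \<mu>.prob_space_distr p_meas_\<mu>)
  have weak: "(\<lambda>k. integral\<^sup>L (empirical_measure I g y (Suc (r k))) \<phi>) \<longlonglongrightarrow> integral\<^sup>L Q \<phi>"
    if \<phi>: "continuous_map ?X euclideanreal \<phi>" "bounded (\<phi> ` (I \<rightarrow>\<^sub>E UNIV))" for \<phi>
  proof -
    have \<phi>_meas: "\<phi> \<in> borel_measurable (borel_RI I)"
      by (rule continuous_imp_borel_RI_measurable[OF \<phi>(1)])
    obtain C where C: "\<And>z. z \<in> I \<rightarrow>\<^sub>E UNIV \<Longrightarrow> norm (\<phi> z) \<le> C"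
      using \<phi>(2) by (auto simp: bounded_iff)
    have "continuous_on UNIV (\<phi> \<circ> p)"
      using continuous_map_compose[OF p_cont \<phi>(1)] by simp
    then have "isCont (\<phi> \<circ> p) x" for x
      by (simp add: continuous_on_eq_continuous_at o_def)
    moreover have "p x \<in> I \<rightarrow>\<^sub>E UNIV" for x
      by (auto simp: p_def)
    then have "norm ((\<phi> \<circ> p) x) \<le> C" for x
      using C[of "p x"] by simp
    ultimately have "(\<lambda>k. integral\<^sup>L ((\<nu> \<circ> r) k) (\<phi> \<circ> p)) \<longlonglongrightarrow> integral\<^sup>L \<mu> (\<phi> \<circ> p)"
      using \<nu>_dist \<mu> by (intro weak_conv_imp_integral_bdd_continuous_conv) (auto simp: o_def)
    moreover have "integral\<^sup>L (empirical_measure I g y (Suc k)) \<phi> = integral\<^sup>L (\<nu> k) (\<phi> \<circ> p)" for k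
    proof -
      have "p \<in> measurable (\<nu> k) (borel_RI I)"
        using p_meas by (simp add: \<nu>_def)
      then show ?thesis
        unfolding emp by (subst integral_distr[OF _ \<phi>_meas]) (auto simp: o_def)
    qed
    moreover have "integral\<^sup>L Q \<phi> = integral\<^sup>L \<mu> (\<phi> \<circ> p)"
      unfolding Q_def by (subst integral_distr[OF p_meas_\<mu> \<phi>_meas]) (simp add: o_def)
    ultimately show ?thesis by simp
  qed
  have g_meas_Q: "g \<in> measurable Q Q"
    using g_meas Q_sets by (simp cong: measurable_cong_sets)
  have "distr Q Q g = Q"
  proof (rule measure_eqI_continuous[OF I _ _ Q_prob Q_sets])
    show "prob_space (distr Q Q g)"
      by (rule prob_space.prob_space_distr[OF Q_prob g_meas_Q])
    show "sets (distr Q Q g) = sets (borel_RI I)"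
      using Q_sets by simp
    fix \<phi> assume \<phi>: "continuous_map ?X euclideanreal \<phi>" "bounded (\<phi> ` (I \<rightarrow>\<^sub>E UNIV))"
    have \<phi>_meas: "\<phi> \<in> borel_measurable (borel_RI I)"
      by (rule continuous_imp_borel_RI_measurable[OF \<phi>(1)])
    have \<phi>g_cont: "continuous_map ?X euclideanreal (\<phi> \<circ> g)"
      by (rule continuous_map_compose[OF g \<phi>(1)])
    have \<phi>g_meas: "\<phi> \<circ> g \<in> borel_measurable (borel_RI I)"
      by (rule continuous_imp_borel_RI_measurable[OF \<phi>g_cont])
    obtain C where C: "\<And>z. z \<in> I \<rightarrow>\<^sub>E UNIV \<Longrightarrow> \<bar>\<phi> z\<bar> \<le> C"
      using \<phi>(2) by (auto simp: bounded_iff)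
    have \<phi>g_bdd: "bounded ((\<phi> \<circ> g) ` (I \<rightarrow>\<^sub>E UNIV))"
      using measurable_space[OF g_meas]
      by (intro bounded_subset[OF \<phi>(2)]) (auto simp: space_borel_RI)
    have "(\<lambda>k. integral\<^sup>L (empirical_measure I g y (Suc (r k))) (\<phi> \<circ> g)
        - integral\<^sup>L (empirical_measure I g y (Suc (r k))) \<phi>) \<longlonglongrightarrow> integral\<^sup>L Q (\<phi> \<circ> g) - integral\<^sup>L Q \<phi>"
      by (intro tendsto_diff weak \<phi> \<phi>g_cont \<phi>g_bdd)
    moreover have "(\<lambda>k. integral\<^sup>L (empirical_measure I g y (Suc (r k))) (\<phi> \<circ> g)
        - integral\<^sup>L (empirical_measure I g y (Suc (r k))) \<phi>) \<longlonglongrightarrow> 0"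
    proof (rule Lim_null_comparison)
      have "(\<lambda>N. 2 * C / real N) \<longlonglongrightarrow> 0"
        by (rule lim_const_over_n)
      from LIMSEQ_subseq_LIMSEQ[OF this, of "\<lambda>k. Suc (r k)"] r
      show "(\<lambda>k. 2 * C / real (Suc (r k))) \<longlonglongrightarrow> 0"
        by (simp add: o_def strict_mono_def)
      have "norm (integral\<^sup>L (empirical_measure I g y N) (\<phi> \<circ> g)
          - integral\<^sup>L (empirical_measure I g y N) \<phi>) \<le> 2 * C / real N" for N
      proof -
        have "integral\<^sup>L (empirical_measure I g y N) (\<phi> \<circ> g)
            - integral\<^sup>L (empirical_measure I g y N) \<phi>
            = ((\<Sum>i<N. \<phi> ((g ^^ Suc i) y)) - (\<Sum>i<N. \<phi> ((g ^^ i) y))) / real N"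
          by (simp add: integral_empirical_measure[OF orbit] \<phi>_meas \<phi>g_meas diff_divide_distrib)
        also have "\<dots> = (\<phi> ((g ^^ N) y) - \<phi> y) / real N"
          unfolding sum_subtractf[symmetric]
          using sum_lessThan_telescope[of "\<lambda>i. \<phi> ((g ^^ i) y)" N] by simp
        finally have "norm (integral\<^sup>L (empirical_measure I g y N) (\<phi> \<circ> g)
            - integral\<^sup>L (empirical_measure I g y N) \<phi>) = \<bar>\<phi> ((g ^^ N) y) - \<phi> y\<bar> / real N"
          by simp
        also have "\<dots> \<le> 2 * C / real N"
          using C[OF orbit[of N]] C[OF y] by (intro divide_right_mono) auto
        finally show ?thesis .
      qed
      then show "\<forall>\<^sub>F k in sequentially. norm (integral\<^sup>L (empirical_measure I g y (Suc (r k))) (\<phi> \<circ> g)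
          - integral\<^sup>L (empirical_measure I g y (Suc (r k))) \<phi>) \<le> 2 * C / real (Suc (r k))"
        by (intro always_eventually allI)
    qed
    ultimately have "integral\<^sup>L Q (\<phi> \<circ> g) = integral\<^sup>L Q \<phi>"
      using LIMSEQ_unique by fastforce
    moreover have "integral\<^sup>L (distr Q Q g) \<phi> = integral\<^sup>L Q (\<phi> \<circ> g)"
      using \<phi>_meas Q_sets
      by (subst integral_distr[OF g_meas_Q]) (simp_all add: o_def cong: measurable_cong_sets)
    ultimately show "integral\<^sup>L (distr Q Q g) \<phi> = integral\<^sup>L Q \<phi>"
      by simp
  qed
  moreover have "bounded_orbit I g y"
    using B(2) unfolding bounded_orbit_def by blast
  moreover have "strict_mono (\<lambda>k. Suc (r k))"
    using r by (simp add: strict_mono_def)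
  ultimately have "kryloff_bogoliuboff_measure I g y Q"
    using weak Q_prob Q_sets g_meas_Q y
    unfolding kryloff_bogoliuboff_measure_def weakly_converges_def by blast
  moreover have "AE z in Q. \<forall>j\<in>I. \<bar>z j\<bar> \<le> B"
  proof -
    have "AE z in Q. \<bar>z j\<bar> \<le> B" if "j \<in> I" for j
    proof -
      have [measurable]: "(\<lambda>z. z j) \<in> borel_measurable (borel_RI I)"
        by (rule measurable_borel_RI_component[OF that])
      show ?thesis
        unfolding Q_def using p_bound[OF that] by (subst AE_distr_iff[OF p_meas_\<mu>]) auto
    qed
    then show ?thesis
      using I by (intro AE_finite_allI) auto
  qed
  ultimately show ?thesis by blast
qed

section \<open>Birkhoff's ergodic theorem\<close>

text \<open>This is the maximum of the Birkhoff sums of \<open>h\<close> over the lengths 0 to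
  \<open>n\<close>, given by the recursion that the maximal inequality exploits.\<close>

primrec maximal_sum :: "('a \<Rightarrow> 'a) \<Rightarrow> ('a \<Rightarrow> real) \<Rightarrow> nat \<Rightarrow> 'a \<Rightarrow> real"
  where
    "maximal_sum T h 0 x = 0"
  | "maximal_sum T h (Suc n) x = max 0 (h x + maximal_sum T h n (T x))"

context
  fixes M :: "'a measure" and T :: "'a \<Rightarrow> 'a"
  assumes prob: "prob_space M"
    and T [measurable]: "T \<in> measurable M M"
    and invariant: "distr M M T = M"
begin

interpretation prob_space M by (rule prob)

lemma integral_invariant:
  fixes h :: "'a \<Rightarrow> real"
  assumes [measurable]: "h \<in> borel_measurable M"
  shows "(\<integral>x. h (T x) \<partial>M) = (\<integral>x. h x \<partial>M)"
  using integral_distr[OF T assms] by (simp add: invariant)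

lemma AE_invariant:
  assumes "AE x in M. P x"
  shows "AE x in M. P ((T ^^ k) x)"
proof (induction k)
  case (Suc k)
  have "AE x in distr M M T. P ((T ^^ k) x)"
    by (subst invariant) (rule Suc)
  from AE_distrD[OF T this] show ?case
    by (simp only: funpow_swap1 funpow.simps o_apply)
qed (use assms in simp)

text \<open>
  Garsia's argument: where \<open>maximal_sum T h (Suc n)\<close> is positive, \<open>h\<close> is at least
  \<open>maximal_sum T h (Suc n) - maximal_sum T h (Suc n) \<circ> T\<close>, whose integral vanishes.
\<close>

lemma maximal_ergodic_inequality:
  fixes h :: "'a \<Rightarrow> real"
  assumes h [measurable]: "h \<in> borel_measurable M"
    and bound: "\<And>x. \<bar>h x\<bar> \<le> C"
    and pos: "\<And>x. x \<in> space M \<Longrightarrow> h x \<noteq> 0 \<Longrightarrow> \<exists>n. 0 < (\<Sum>i<n. h ((T ^^ i) x))"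
  shows "0 \<le> (\<integral>x. h x \<partial>M)"
proof -
  let ?m = "maximal_sum T h"
  have m_mono: "?m n x \<le> ?m (Suc n) x" for n x
  proof (induction n arbitrary: x)
    case (Suc n)
    have "h x + ?m n (T x) \<le> h x + ?m (Suc n) (T x)"
      by (rule add_left_mono) (rule Suc)
    then show ?case
      unfolding maximal_sum.simps(2)[of T h n x] maximal_sum.simps(2)[of T h "Suc n" x]
      by (rule max.mono[OF order.refl])
  qed simp
  have m_nonneg: "0 \<le> ?m n x" for n x
    by (cases n) auto
  have m_sum: "(\<Sum>i<n. h ((T ^^ i) x)) \<le> ?m n x" for n x
  proof (induction n arbitrary: x)
    case (Suc n)
    have "(\<Sum>i<Suc n. h ((T ^^ i) x)) = h x + (\<Sum>i<n. h ((T ^^ i) (T x)))"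
      by (simp add: sum.lessThan_Suc_shift funpow_swap1 del: sum.lessThan_Suc)
    then show ?case using Suc[of "T x"] by simp
  qed simp
  have m_meas [measurable]: "?m n \<in> borel_measurable M" for n
  proof (induction n)
    case (Suc n)
    note Suc [measurable]
    have "?m (Suc n) = (\<lambda>x. max 0 (h x + ?m n (T x)))" by auto
    then show ?case by simp
  qed simp
  have C: "0 \<le> C" using bound[of undefined] by linarith
  have m_bound: "?m n x \<le> real n * C" for n x
  proof (induction n arbitrary: x)
    case (Suc n)
    from Suc[of "T x"] bound[of x] C show ?case
      by (auto simp: algebra_simps)
  qed simp
  have m_int: "integrable M (?m n)" for n
    by (rule integrable_const_bound[of _ "real n * C"]) (auto simp: m_nonneg m_bound)
  have mT_int: "integrable M (\<lambda>x. ?m n (T x))" for n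
    by (rule integrable_const_bound[of _ "real n * C"]) (auto simp: m_nonneg m_bound)
  \<comment> \<open>The truncations tend to \<open>h\<close>: where \<open>h\<close> vanishes they
    vanish too, and elsewhere \<open>pos\<close> makes the maximal sum positive from some index
    on.\<close>
  define k where "k n x = (if 0 < ?m (Suc n) x then h x else 0)" for n x
  have k_meas [measurable]: "k n \<in> borel_measurable M" for n
    unfolding k_def [abs_def] by measurable
  have k_bound: "\<bar>k n x\<bar> \<le> C" for n x
    using bound C by (simp add: k_def)
  have k_nonneg: "0 \<le> (\<integral>x. k n x \<partial>M)" for n
  proof -
    have "0 = (\<integral>x. ?m (Suc n) x - ?m (Suc n) (T x) \<partial>M)"
      by (subst Bochner_Integration.integral_diff[OF m_int mT_int])
         (simp only: integral_invariant[OF m_meas] diff_self)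
    also have "\<dots> \<le> (\<integral>x. k n x \<partial>M)"
    proof (rule integral_mono)
      show "integrable M (\<lambda>x. ?m (Suc n) x - ?m (Suc n) (T x))"
        by (intro Bochner_Integration.integrable_diff m_int mT_int)
      show "integrable M (k n)"
        by (rule integrable_const_bound[of _ C]) (auto simp: k_bound)
      show "?m (Suc n) x - ?m (Suc n) (T x) \<le> k n x" for x
      proof (cases "0 < ?m (Suc n) x")
        case True
        then have "?m (Suc n) x = h x + ?m n (T x)"
          by (simp add: max_def split: if_splits)
        moreover have "k n x = h x"
          using True unfolding k_def by (rule if_P)
        ultimately show ?thesis
          using m_mono[of n "T x"] by linarith
      next
        case False
        then have "k n x = 0"
          unfolding k_def by (rule if_not_P)
        with False m_nonneg[of "Suc n" "T x"] show ?thesis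
          by linarith
      qed
    qed
    finally show ?thesis .
  qed
  have "(\<lambda>n. \<integral>x. k n x \<partial>M) \<longlonglongrightarrow> (\<integral>x. h x \<partial>M)"
  proof (rule integral_dominated_convergence[where w = "\<lambda>_. C"])
    show "AE x in M. (\<lambda>n. k n x) \<longlonglongrightarrow> h x"
    proof (rule AE_I2)
      fix x assume x: "x \<in> space M"
      show "(\<lambda>n. k n x) \<longlonglongrightarrow> h x"
      proof (cases "h x = 0")
        case False
        then obtain n where "0 < (\<Sum>i<n. h ((T ^^ i) x))"
          using pos x by blast
        then have n: "0 < ?m n x" using m_sum[of x n] by linarith
        have "k j x = h x" if "j \<ge> n" for j
        proof -
          have "?m n x \<le> ?m (Suc j) x"
            by (rule lift_Suc_mono_le[of "\<lambda>n. ?m n x", OF m_mono]) (use that in simp)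
          with n have "0 < ?m (Suc j) x" by linarith
          then show ?thesis unfolding k_def by (rule if_P)
        qed
        then show ?thesis
          by (intro tendsto_eventually) (auto simp: eventually_sequentially)
      next
        case True
        then have "k n x = 0" for n
          unfolding k_def by (simp only: if_cancel)
        then show ?thesis
          using True by simp
      qed
    qed
  qed (auto simp: k_bound)
  then show ?thesis
    by (rule LIMSEQ_le_const) (auto simp: k_nonneg)
qed

text \<open>For \<open>a < b\<close>, let \<open>E\<close> be the set where the lower limit of the
  averages is below \<open>a\<close> and the upper limit above \<open>b\<close>. It is invariant, so
  the maximal inequality applied on \<open>E\<close> to \<open>f - b\<close> and to
  \<open>a - f\<close> gives \<open>b * prob E \<le> a * prob E\<close>, whence \<open>E\<close> is
  null. Countably many rational pairs cover all points of divergence.\<close>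

theorem birkhoff_bounded:
  fixes f :: "'a \<Rightarrow> real"
  assumes f [measurable]: "f \<in> borel_measurable M"
    and bound: "\<And>x. \<bar>f x\<bar> \<le> C"
  shows "AE x in M. convergent (\<lambda>N. (\<Sum>i<N. f ((T ^^ i) x)) / real N)"
proof -
  define A where "A N x = (\<Sum>i<N. f ((T ^^ i) x)) / real N" for N x
  define u where "u x = limsup (\<lambda>N. ereal (A N x))" for x
  define l where "l x = liminf (\<lambda>N. ereal (A N x))" for x
  have Tk [measurable]: "(T ^^ i) \<in> measurable M M" for i
    by (induction i) auto
  have A_meas [measurable]: "A N \<in> borel_measurable M" for N
    unfolding A_def [abs_def] by measurable
  have [measurable]: "u \<in> borel_measurable M" "l \<in> borel_measurable M"
    unfolding u_def [abs_def] l_def [abs_def] by measurable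
  have C: "0 \<le> C" using bound[of undefined] by linarith
  have A_bound: "\<bar>A N x\<bar> \<le> C" for N x
  proof -
    have "\<bar>\<Sum>i<N. f ((T ^^ i) x)\<bar> \<le> real N * C"
      by (rule order_trans[OF sum_abs]) (use sum_bounded_above[of "{..<N}" _ C] bound in auto)
    then show ?thesis
      using C by (cases "N = 0") (auto simp: A_def field_simps)
  qed
  \<comment> \<open>One step of \<open>T\<close> changes a Birkhoff sum by two bounded terms, so
    \<open>u\<close> and \<open>l\<close> are invariant at every point, not merely almost
    everywhere.\<close>
  have shift: "(\<lambda>N. ereal (A N (T x) - A N x)) \<longlonglongrightarrow> 0" for x
  proof -
    have "A N (T x) - A N x = (f ((T ^^ N) x) - f x) / real N" for N
    proof -
      have "(\<Sum>i<N. f ((T ^^ i) (T x))) + f x = (\<Sum>i<N. f ((T ^^ i) x)) + f ((T ^^ N) x)"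
        using sum.lessThan_Suc_shift[of "\<lambda>i. f ((T ^^ i) x)" N]
        by (simp add: funpow_swap1)
      then show ?thesis
        by (simp add: A_def diff_divide_distrib [symmetric])
    qed
    moreover have "(\<lambda>N. (f ((T ^^ N) x) - f x) / real N) \<longlonglongrightarrow> 0"
    proof (rule Lim_null_comparison)
      show "(\<lambda>N. 2 * C / real N) \<longlonglongrightarrow> 0"
        by (rule lim_const_over_n)
      have "\<bar>f ((T ^^ N) x) - f x\<bar> \<le> 2 * C" for N
        using bound[of "(T ^^ N) x"] bound[of x] by linarith
      then show "\<forall>\<^sub>F N in sequentially. norm ((f ((T ^^ N) x) - f x) / real N) \<le> 2 * C / real N"
        by (auto simp: divide_right_mono)
    qed
    ultimately show ?thesis
      by (simp add: zero_ereal_def)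
  qed
  have u_inv: "u (T x) = u x" and l_inv: "l (T x) = l x" for x
    using ereal_limsup_lim_add[OF shift[of x], of "\<lambda>N. ereal (A N x)"]
      ereal_liminf_lim_add[OF shift[of x], of "\<lambda>N. ereal (A N x)"]
    by (simp_all add: u_def l_def)
  have null: "AE x in M. \<not> (l x < ereal a \<and> ereal b < u x)" if "a < b" for a b
  proof -
    define E where "E = {x \<in> space M. l x < ereal a \<and> ereal b < u x}"
    have E [measurable]: "E \<in> sets M"
      unfolding E_def by measurable
    have E_inv: "(T ^^ i) x \<in> E" if "x \<in> E" for x i
      using that measurable_space[OF T] by (induction i) (auto simp: E_def u_inv l_inv)
    \<comment> \<open>The sign \<open>s\<close> treats upper and lower limits together. On
      \<open>E\<close> the indicator is 1 along the whole orbit, so the truncated sums are the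
      ordinary ones. The condition \<open>n \<ge> 1\<close> discards \<open>A 0 x\<close>, which is
      0 by division by zero.\<close>
    have key: "0 \<le> (\<integral>x. s * (f x - c) * indicator E x \<partial>M)"
      if *: "\<And>x. x \<in> E \<Longrightarrow> \<exists>n\<ge>1. 0 < s * (A n x - c)" for s c
    proof (rule maximal_ergodic_inequality)
      show "\<bar>s * (f x - c) * indicator E x\<bar> \<le> \<bar>s\<bar> * (C + \<bar>c\<bar>)" for x
        using bound[of x] C by (auto simp: indicator_def abs_mult intro!: mult_left_mono)
      fix x assume "s * (f x - c) * indicator E x \<noteq> 0"
      then have x: "x \<in> E" by (auto simp: indicator_def split: if_splits)
      then obtain n where n: "n \<ge> 1" "0 < s * (A n x - c)" using * by blast
      have "(\<Sum>i<n. s * (f ((T ^^ i) x) - c) * indicator E ((T ^^ i) x))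
          = s * ((\<Sum>i<n. f ((T ^^ i) x)) - real n * c)"
        using E_inv[OF x] by (simp add: sum_distrib_left[symmetric] sum_subtractf)
      also have "\<dots> = real n * (s * (A n x - c))"
        using n by (simp add: A_def field_simps)
      also have "\<dots> > 0"
        by (intro mult_pos_pos[OF _ n(2)]) (use n(1) in simp)
      finally show "\<exists>n. 0 < (\<Sum>i<n. s * (f ((T ^^ i) x) - c) * indicator E ((T ^^ i) x))" ..
    qed simp
    have "0 \<le> (\<integral>x. 1 * (f x - b) * indicator E x \<partial>M)"
    proof (rule key)
      fix x assume x: "x \<in> E"
      show "\<exists>n\<ge>1. 0 < 1 * (A n x - b)"
      proof (rule ccontr)
        assume "\<not> (\<exists>n\<ge>1. 0 < 1 * (A n x - b))"
        then have "\<forall>\<^sub>F n in sequentially. ereal (A n x) \<le> ereal b"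
          unfolding eventually_sequentially by (auto simp: not_less)
        then have "u x \<le> ereal b"
          unfolding u_def by (rule Limsup_bounded)
        then show False using x by (auto simp: E_def)
      qed
    qed
    moreover have "0 \<le> (\<integral>x. (-1) * (f x - a) * indicator E x \<partial>M)"
    proof (rule key)
      fix x assume x: "x \<in> E"
      show "\<exists>n\<ge>1. 0 < (-1) * (A n x - a)"
      proof (rule ccontr)
        assume "\<not> (\<exists>n\<ge>1. 0 < (-1) * (A n x - a))"
        then have "\<forall>\<^sub>F n in sequentially. ereal a \<le> ereal (A n x)"
          unfolding eventually_sequentially by (auto simp: not_less)
        then have "ereal a \<le> l x"
          unfolding l_def by (rule Liminf_bounded)
        then show False using x by (auto simp: E_def)
      qed
    qed
    moreover have int: "integrable M (\<lambda>x. c * (f x - d) * indicator E x)" for c d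
    proof (rule integrable_const_bound[of _ "\<bar>c\<bar> * (C + \<bar>d\<bar>)"])
      have "\<bar>f x - d\<bar> \<le> C + \<bar>d\<bar>" for x
        using bound[of x] by linarith
      then show "AE x in M. norm (c * (f x - d) * indicator E x) \<le> \<bar>c\<bar> * (C + \<bar>d\<bar>)"
        using C by (auto simp: indicator_def abs_mult intro!: mult_left_mono)
    qed simp
    ultimately have "0 \<le> (\<integral>x. 1 * (f x - b) * indicator E x + (-1) * (f x - a) * indicator E x \<partial>M)"
      by (subst Bochner_Integration.integral_add[OF int int]) (rule add_nonneg_nonneg)
    also have "\<dots> = (\<integral>x. (a - b) * indicator E x \<partial>M)"
      by (rule Bochner_Integration.integral_cong) (auto simp: indicator_def)
    also have "\<dots> = (a - b) * prob E"
      by simp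
    finally have "prob E \<le> 0"
      using \<open>a < b\<close> by (simp add: zero_le_mult_iff)
    then have "prob E = 0"
      by (simp add: antisym)
    then have "AE x in M. x \<notin> E"
      using E by (simp add: prob_eq_0)
    then show ?thesis
      by (auto simp: E_def)
  qed
  have "AE x in M. \<forall>(a, b) \<in> {(a, b) \<in> \<rat> \<times> \<rat>. a < b}. \<not> (l x < ereal a \<and> ereal b < u x)"
  proof (rule AE_ball_countable')
    show "countable {(a, b) \<in> \<rat> \<times> \<rat>. a < (b :: real)}"
      by (rule countable_subset[of _ "\<rat> \<times> \<rat>"]) (auto intro: countable_rat)
  qed (use null in auto)
  then show ?thesis
  proof (rule AE_mp, intro AE_I2 impI)
    fix x
    assume *: "\<forall>(a, b) \<in> {(a, b) \<in> \<rat> \<times> \<rat>. a < b}. \<not> (l x < ereal a \<and> ereal b < u x)"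
    have "ereal (- C) \<le> l x"
      unfolding l_def using A_bound by (intro Liminf_bounded always_eventually) (auto simp: abs_le_iff minus_le_iff)
    moreover have "u x \<le> ereal C"
      unfolding u_def using A_bound by (intro Limsup_bounded always_eventually) (auto simp: abs_le_iff)
    moreover have lu: "l x \<le> u x"
      unfolding l_def u_def by (rule Liminf_le_Limsup) simp
    ultimately obtain r s where rs: "l x = ereal r" "u x = ereal s"
      by (cases "l x"; cases "u x") auto
    have "\<not> r < s"
    proof
      assume "r < s"
      then obtain a where a: "a \<in> \<rat>" "r < a" "a < s" using Rats_dense_in_real by blast
      then obtain b where "b \<in> \<rat>" "a < b" "b < s" using Rats_dense_in_real by blast
      with a * rs show False by auto
    qed
    with lu rs have "u x = ereal r" by auto
    then have "(\<lambda>N. ereal (A N x)) \<longlonglongrightarrow> ereal r"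
      by (subst tendsto_iff_Liminf_eq_Limsup) (use rs in \<open>simp_all add: l_def u_def\<close>)
    then have "(\<lambda>N. A N x) \<longlonglongrightarrow> r"
      by simp
    then show "convergent (\<lambda>N. (\<Sum>i<N. f ((T ^^ i) x)) / real N)"
      unfolding A_def by (rule convergentI)
  qed
qed

end

section \<open>The junction dynamics\<close>

lemma abs_diff_le_of_unit_steps:
  fixes h :: "nat \<Rightarrow> real"
  assumes "\<And>d. Suc d < N \<Longrightarrow> \<bar>h (Suc d) - h d\<bar> \<le> 1" and "d < N"
  shows "\<bar>h d - h 0\<bar> \<le> real d"
  using assms(2)
proof (induction d)
  case (Suc d)
  then have "\<bar>h (Suc d) - h d\<bar> \<le> 1" "\<bar>h d - h 0\<bar> \<le> real d"
    using assms(1)[of d] by simp_all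
  then show ?case
    unfolding of_nat_Suc by linarith
qed simp

locale junction =
  fixes n m :: nat and a :: "nat \<Rightarrow> real"
  assumes n: "n \<ge> 2" and m: "m \<ge> 2"
    and a: "\<And>i. i \<in> {1..n + m} \<Longrightarrow> 0 \<le> a i \<and> a i \<le> 1"
    and a_sum: "a n + a (n + m) \<le> 1"
begin

section \<open>Branches of the map, translation equivariance and the passage to differences\<close>

lemma abar_bounds:
  assumes "i \<in> {1..n + m}"
  shows "0 \<le> abar n m a i" "abar n m a i \<le> 1"
  using a[OF assms] a[of n] a[of "n + m"] n a_sum by (auto simp: abar_def)

lemma abar_junction: "abar n m a (n + m) = abar n m a n"
  by (simp add: abar_def)

lemma junction_map_exit:
  "junction_map n m a q n = min (abar n m a n + q 1 + q (n + 1) - q (n + m)) (a (n - 1) + q (n - 1))"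
  "junction_map n m a q (n + m) =
    min (abar n m a n + q 1 + q (n + 1) - junction_map n m a q n) (a (n + m - 1) + q (n + m - 1))"
  using n m by (simp_all add: junction_map_def junction_n_def abar_junction)

lemma junction_map_entry:
  "junction_map n m a q 1 = min (a n + (q n / 2 + q (n + m) / 2)) (abar n m a 1 + q 2)"
  "junction_map n m a q (n + 1) =
    min (a (n + m) + (q n / 2 + q (n + m) / 2)) (abar n m a (n + 1) + q (n + 2))"
  using n m by (simp_all add: junction_map_def add_divide_distrib)

lemma junction_map_interior:
  assumes "i \<in> {1..n + m} - {1, n, n + 1, n + m}"
  shows "junction_map n m a q i = min (a (i - 1) + q (i - 1)) (abar n m a i + q (i + 1))"
  using assms by (simp add: junction_map_def)

lemma junction_cases [consumes 1, case_names exit1 exit2 entry1 entry2 interior]: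
  assumes "i \<in> {1..n + m}"
    and "i = n \<Longrightarrow> P" "i = n + m \<Longrightarrow> P" "i = 1 \<Longrightarrow> P" "i = n + 1 \<Longrightarrow> P"
    and "i \<in> {1..n + m} - {1, n, n + 1, n + m} \<Longrightarrow> i - 1 \<in> {1..n + m} \<Longrightarrow> i + 1 \<in> {1..n + m} \<Longrightarrow> P"
  shows P
proof (cases "i \<in> {1, n, n + 1, n + m}")
  case False
  then have "i - 1 \<in> {1..n + m}" "i + 1 \<in> {1..n + m}"
    using assms(1) by auto
  with False assms(1,6) show P by blast
qed (use assms(2-5) in auto)

lemma road_indices:
  "1 \<in> {1..n + m}" "2 \<in> {1..n + m}" "n - 1 \<in> {1..n + m}" "n \<in> {1..n + m}" "n + 1 \<in> {1..n + m}"
  "n + 2 \<in> {1..n + m}" "n + m - 1 \<in> {1..n + m}" "n + m \<in> {1..n + m}"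
  using n m by auto

text \<open>In every argument of a minimum the coefficients of the components add up to 1, counting
  \<open>1 + 1 - 1\<close> at the exits and two halves at the entries. Exit \<open>n\<close> is
  treated separately because exit \<open>n + m\<close> uses its new value. Agreement is assumed on
  the indices only, as difference vectors are undefined elsewhere.\<close>

lemma junction_map_shift:
  assumes q: "\<And>j. j \<in> {1..n + m} \<Longrightarrow> q' j = q j + c" and i: "i \<in> {1..n + m}"
  shows "junction_map n m a q' i = junction_map n m a q i + c"
proof -
  note q_at = road_indices[THEN q]
  have exit: "junction_map n m a q' n = junction_map n m a q n + c"
    unfolding junction_map_exit(1) q_at by (simp add: min_add_distrib_left algebra_simps)
  show ?thesis
    using i
  proof (cases rule: junction_cases)
    case exit1
    with exit show ?thesis by simp
  next
    case exit2
    show ?thesis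
      unfolding exit2 junction_map_exit(2) exit q_at by (simp add: min_add_distrib_left algebra_simps)
  next
    case entry1
    show ?thesis
      unfolding entry1 junction_map_entry(1) q_at add_divide_distrib by linarith
  next
    case entry2
    show ?thesis
      unfolding entry2 junction_map_entry(2) q_at add_divide_distrib by linarith
  next
    case interior
    show ?thesis
      unfolding junction_map_interior[OF interior(1)] q[OF interior(2)] q[OF interior(3)]
      by (simp add: min_add_distrib_left algebra_simps)
  qed
qed

lemma junction_map_differences:
  assumes "i \<in> {1..n + m}"
  shows "junction_map n m a ((differences n m q)(1 := 0)) i = junction_map n m a q i - q 1"
proof -
  have "((differences n m q)(1 := 0)) j = q j + - q 1" if "j \<in> {1..n + m}" for j
    using that by (auto simp: differences_def)
  from junction_map_shift[where q = q and q' = "(differences n m q)(1 := 0)" and c = "- q 1",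
      OF this assms]
  show ?thesis
    by simp
qed

lemma difference_map_differences:
  "difference_map n m a (differences n m q) = differences n m (junction_map n m a q)"
proof
  fix j
  have "j \<in> {1..n + m}" if "j \<in> {2..n + m}"
    using that by auto
  then show "difference_map n m a (differences n m q) j = differences n m (junction_map n m a q) j"
    using junction_map_differences[of j q] junction_map_differences[of 1 q] road_indices(1)
    by (auto simp: difference_map_def differences_def[of n m "junction_map n m a _"])
qed

lemma funpow_difference_map:
  "(difference_map n m a ^^ k) (differences n m q) = differences n m ((junction_map n m a ^^ k) q)"
  by (induction k) (simp_all add: difference_map_differences)

section \<open>Continuity of the dynamics\<close>

lemma junction_map_continuous:
  assumes h: "\<And>j. j \<in> {1..n + m} \<Longrightarrow> continuous_map X euclideanreal (\<lambda>x. h x j)"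
    and i: "i \<in> {1..n + m}"
  shows "continuous_map X euclideanreal (\<lambda>x. junction_map n m a (h x) i)"
proof -
  note intros = continuous_map_real_min continuous_map_add continuous_map_diff
    continuous_map_real_divide continuous_map_const[THEN iffD2] h road_indices
  have exit: "continuous_map X euclideanreal (\<lambda>x. junction_map n m a (h x) n)"
    unfolding junction_map_exit(1) by (intro intros) auto
  show ?thesis
    using i
  proof (cases rule: junction_cases)
    case exit1
    with exit show ?thesis by simp
  next
    case exit2
    show ?thesis
      unfolding exit2 junction_map_exit(2) by (intro intros exit) auto
  next
    case entry1
    show ?thesis
      unfolding entry1 junction_map_entry(1) by (intro intros) auto
  next
    case entry2
    show ?thesis
      unfolding entry2 junction_map_entry(2) by (intro intros) auto
  next
    case interior
    show ?thesis
      unfolding junction_map_interior[OF interior(1)] by (intro intros interior(2,3)) auto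
  qed
qed

lemma junction_map_continuous_differences:
  assumes "i \<in> {1..n + m}"
  shows "continuous_map (product_topology (\<lambda>_. euclideanreal) {2..n + m}) euclideanreal
    (\<lambda>y. junction_map n m a (y(1 := 0)) i)"
proof (rule junction_map_continuous[OF _ assms])
  fix j assume j: "j \<in> {1..n + m}"
  show "continuous_map (product_topology (\<lambda>_. euclideanreal) {2..n + m}) euclideanreal
      (\<lambda>y. (y(1 := 0)) j)"
  proof (cases "j = 1")
    case False
    with j have "j \<in> {2..n + m}" by auto
    from continuous_map_product_projection[OF this, of "\<lambda>_. euclideanreal"] False
    show ?thesis by simp
  qed simp
qed

lemma difference_map_continuous:
  "continuous_map (product_topology (\<lambda>_. euclideanreal) {2..n + m})
    (product_topology (\<lambda>_. euclideanreal) {2..n + m}) (difference_map n m a)"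
  unfolding continuous_map_componentwise
proof (intro conjI ballI)
  show "difference_map n m a ` topspace (product_topology (\<lambda>_. euclideanreal) {2..n + m})
      \<subseteq> extensional {2..n + m}"
    by (auto simp: difference_map_def differences_def)
  fix j assume j: "j \<in> {2..n + m}"
  then have "j \<in> {1..n + m}" by auto
  from continuous_map_diff[OF junction_map_continuous_differences[OF this]
      junction_map_continuous_differences[OF road_indices(1)]]
  show "continuous_map (product_topology (\<lambda>_. euclideanreal) {2..n + m}) euclideanreal
      (\<lambda>y. difference_map n m a y j)"
    using j by (simp add: difference_map_def differences_def)
qed

section \<open>Increasing orbits and bounded differences\<close>

text \<open>
  The map is not monotone because of the terms \<open>- q (n + m)\<close> and \<open>- q n\<close>. Nevertheless
  orbits that start increasing stay increasing: since \<open>abar\<close> agrees at the two exits, each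
  bound at the junction yields one for the other exit at the next half step.
\<close>

lemma junction_map_increasing_step:
  assumes p: "\<And>j. j \<in> {1..n + m} \<Longrightarrow> p j \<le> junction_map n m a p j"
    and i: "i \<in> {1..n + m}"
  shows "junction_map n m a p i \<le> junction_map n m a (junction_map n m a p) i"
proof -
  define q where "q = junction_map n m a p"
  have pq: "p j \<le> q j" if "j \<in> {1..n + m}" for j
    using p[OF that] by (simp add: q_def)
  note at = road_indices[THEN pq]
  \<comment> \<open>The second exit is capped by what the first one leaves over. Solved for
    \<open>q n\<close>, and with \<open>p\<close> replaced by the larger \<open>q\<close>, this is
    the junction bound for exit \<open>n\<close> at the next step.\<close>
  have sum: "q n + q (n + m) \<le> abar n m a n + p 1 + p (n + 1)"
    using junction_map_exit(2)[of p] by (simp add: q_def min_def split: if_splits)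
  have "q i \<le> junction_map n m a q i"
    using i
  proof (cases rule: junction_cases)
    case exit1
    have "q n \<le> a (n - 1) + p (n - 1)"
      unfolding q_def junction_map_exit(1) by simp
    then show ?thesis
      unfolding exit1 junction_map_exit(1) using sum at by (intro min.boundedI) linarith+
  next
    case exit2
    have "q (n + m) \<le> a (n + m - 1) + p (n + m - 1)"
      unfolding q_def junction_map_exit(2) by simp
    \<comment> \<open>Solved for \<open>q (n + m)\<close>, this is the junction bound for exit
      \<open>n + m\<close>, whose update uses the same new value at exit \<open>n\<close>.\<close>
    moreover have "junction_map n m a q n \<le> abar n m a n + q 1 + q (n + 1) - q (n + m)"
      unfolding junction_map_exit(1) by simp
    ultimately show ?thesis
      unfolding exit2 junction_map_exit(2) using at by (intro min.boundedI) linarith+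
  next
    case entry1
    show ?thesis
      unfolding entry1 junction_map_entry(1) q_def[THEN fun_cong, of 1]
      using at by (intro min.mono) linarith+
  next
    case entry2
    show ?thesis
      unfolding entry2 junction_map_entry(2) q_def[THEN fun_cong, of "n + 1"]
      using at by (intro min.mono) linarith+
  next
    case interior
    show ?thesis
      unfolding junction_map_interior[OF interior(1)] q_def[THEN fun_cong, of i]
      using pq[OF interior(2)] pq[OF interior(3)] by (intro min.mono) linarith+
  qed
  then show ?thesis by (simp add: q_def)
qed

lemma junction_orbit_increasing:
  assumes "i \<in> {1..n + m}"
  shows "(junction_map n m a ^^ k) (\<lambda>_. 0) i \<le> (junction_map n m a ^^ Suc k) (\<lambda>_. 0) i"
  using assms
proof (induction k arbitrary: i)
  case 0
  note pos = a[THEN conjunct1] abar_bounds(1)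
  \<comment> \<open>From zero, the junction term at exit \<open>n + m\<close> is the common
    \<open>abar\<close> minus the new value at exit \<open>n\<close>; this bound makes it
    nonnegative.\<close>
  have exit: "junction_map n m a (\<lambda>_. 0) n \<le> abar n m a n"
    unfolding junction_map_exit(1) by simp
  from 0 have "0 \<le> junction_map n m a (\<lambda>_. 0) i"
  proof (cases rule: junction_cases)
    case exit1
    then show ?thesis
      unfolding exit1 junction_map_exit(1) using road_indices[THEN pos(1)] road_indices[THEN pos(2)]
      by simp
  next
    case exit2
    then show ?thesis
      unfolding exit2 junction_map_exit(2)
      using exit road_indices[THEN pos(1)] road_indices[THEN pos(2)] by simp
  next
    case entry1
    then show ?thesis
      unfolding entry1 junction_map_entry(1) using road_indices[THEN pos(1)] road_indices[THEN pos(2)]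
      by simp
  next
    case entry2
    then show ?thesis
      unfolding entry2 junction_map_entry(2) using road_indices[THEN pos(1)] road_indices[THEN pos(2)]
      by simp
  next
    case interior
    then show ?thesis
      using pos(1)[OF interior(2)] pos(2)[OF 0]
      by (simp add: junction_map_interior[OF interior(1)])
  qed
  then show ?case by simp
next
  case (Suc k)
  show ?case
    using junction_map_increasing_step[of "(junction_map n m a ^^ k) (\<lambda>_. 0)", OF _ Suc.prems] Suc.IH
    by simp
qed

lemma differences_bounded_of_increasing:
  assumes q: "\<And>j. j \<in> {1..n + m} \<Longrightarrow> q j \<le> junction_map n m a q j"
    and i: "i \<in> {1..n + m}"
  shows "\<bar>q i - q 1\<bar> \<le> 2 * real n + 2 * real m + 2"
proof -
  have up: "q j \<le> 1 + q (j - 1)" if "j \<in> {1..n + m}" "j \<noteq> 1" "j \<noteq> n + 1" for j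
  proof -
    have "junction_map n m a q j \<le> a (j - 1) + q (j - 1)"
      using that(1)
    proof (cases rule: junction_cases)
      case exit1
      show ?thesis unfolding exit1 junction_map_exit(1) by simp
    next
      case exit2
      show ?thesis unfolding exit2 junction_map_exit(2) by simp
    next
      case interior
      show ?thesis unfolding junction_map_interior[OF interior(1)] by simp
    qed (use that in auto)
    moreover have "j - 1 \<in> {1..n + m}"
      using that by (auto simp: Suc_le_eq)
    then have "a (j - 1) \<le> 1"
      using a by blast
    ultimately show ?thesis using q[OF that(1)] by linarith
  qed
  have down: "q j \<le> 1 + q (j + 1)" if "j \<in> {1..n + m}" "j \<noteq> n" "j \<noteq> n + m" for j
  proof -
    have "junction_map n m a q j \<le> abar n m a j + q (j + 1)"
      using that(1)
    proof (cases rule: junction_cases)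
      case entry1
      show ?thesis unfolding entry1 junction_map_entry(1) by (simp add: numeral_2_eq_2)
    next
      case entry2
      show ?thesis unfolding entry2 junction_map_entry(2) by simp
    next
      case interior
      show ?thesis unfolding junction_map_interior[OF interior(1)] by simp
    qed (use that in auto)
    then show ?thesis using q[OF that(1)] abar_bounds(2)[OF that(1)] by linarith
  qed
  \<comment> \<open>Between neighbours on one road both \<open>up\<close> and \<open>down\<close>
    apply: the larger index is no entry and the smaller one no exit.\<close>
  have road1: "\<bar>q (d + 1) - q 1\<bar> \<le> real n" if "d < n" for d
  proof -
    have "\<bar>q (Suc d + 1) - q (d + 1)\<bar> \<le> 1" if "Suc d < n" for d
      using up[of "Suc d + 1"] down[of "d + 1"] that m by auto
    from abs_diff_le_of_unit_steps[of n "\<lambda>d. q (d + 1)", OF this that] that show ?thesis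
      by simp
  qed
  have road2: "\<bar>q (d + n + 1) - q (n + 1)\<bar> \<le> real m" if "d < m" for d
  proof -
    have "\<bar>q (Suc d + n + 1) - q (d + n + 1)\<bar> \<le> 1" if "Suc d < m" for d
      using up[of "Suc d + n + 1"] down[of "d + n + 1"] that n by auto
    from abs_diff_le_of_unit_steps[of m "\<lambda>d. q (d + n + 1)", OF this that] that show ?thesis
      by simp
  qed
  have ends: "\<bar>q n - q 1\<bar> \<le> real n" "\<bar>q (n + m) - q (n + 1)\<bar> \<le> real m"
    using road1[of "n - 1"] road2[of "m - 1"] n m by (auto simp: add.commute)
  \<comment> \<open>With \<open>ends\<close> this gives
    \<open>q 1 \<le> 1 + (q 1 + q (n + 1) + n + m) / 2\<close>, that is,
    \<open>q 1 - q (n + 1) \<le> 2 + n + m\<close>; the other entry gives the opposite sign. Adding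
    at most \<open>m\<close> along the second road stays within the claimed constant.\<close>
  have "q 1 \<le> 1 + (q n / 2 + q (n + m) / 2)"
    using q[OF road_indices(1)] a[OF road_indices(4)] unfolding junction_map_entry(1) by linarith
  moreover have "q (n + 1) \<le> 1 + (q n / 2 + q (n + m) / 2)"
    using q[OF road_indices(5)] a[OF road_indices(8)] unfolding junction_map_entry(2) by linarith
  ultimately have link: "\<bar>q (n + 1) - q 1\<bar> \<le> 2 + real n + real m"
    using ends by linarith
  show ?thesis
  proof (cases "i \<le> n")
    case True
    with i have "i - 1 < n" "i - 1 + 1 = i" by auto
    with road1[of "i - 1"] have "\<bar>q i - q 1\<bar> \<le> real n" by simp
    then show ?thesis
      by linarith
  next
    case False
    define d where "d = i - (n + 1)"
    have d: "d < m" "i = d + n + 1"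
      using False i by (auto simp: d_def)
    from road2[OF d(1)] link show ?thesis
      unfolding d(2) by linarith
  qed
qed

lemma junction_orbit_bound:
  assumes "j \<in> {2..n + m}"
  shows "\<bar>(difference_map n m a ^^ k) (differences n m (\<lambda>_. 0)) j\<bar> \<le> 2 * real n + 2 * real m + 2"
proof -
  have "j \<in> {1..n + m}" using assms by auto
  from differences_bounded_of_increasing[OF _ this, of "(junction_map n m a ^^ k) (\<lambda>_. 0)"]
  show ?thesis
    using junction_orbit_increasing[of _ k] assms
    unfolding funpow_difference_map by (simp add: differences_def)
qed

section \<open>Growth of the first component as a Birkhoff sum\<close>

lemma junction_first_increment:
  "junction_map n m a q 1 - q 1 = junction_map n m a ((differences n m q)(1 := 0)) 1"
  by (rule junction_map_differences[OF road_indices(1), symmetric])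

lemma junction_first_orbit:
  "(junction_map n m a ^^ N) q 1 - q 1 =
    (\<Sum>k<N. junction_map n m a (((difference_map n m a ^^ k) (differences n m q))(1 := 0)) 1)"
proof (induction N)
  case (Suc N)
  with junction_first_increment[of "(junction_map n m a ^^ N) q"] show ?case
    unfolding sum.lessThan_Suc funpow.simps o_apply funpow_difference_map by linarith
qed simp

end

theorem theorem7:
  fixes n m :: nat and a :: "nat \<Rightarrow> real"
  assumes "n \<ge> 2" and "m \<ge> 2"
    and "\<And>i. i \<in> {1..n + m} \<Longrightarrow> 0 \<le> a i \<and> a i \<le> 1"
    and "a n + a (n + m) \<le> 1"
  shows "\<exists>Q. kryloff_bogoliuboff_measure {2..n + m} (difference_map n m a)
               (differences n m (\<lambda>_. 0)) Q \<and>
           (AE y in Q. \<exists>flow::real. \<forall>q\<^sub>0. differences n m q\<^sub>0 = y \<longrightarrow>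
              (\<forall>i\<in>{1..n + m}.
                 (\<lambda>k. (junction_map n m a ^^ k) q\<^sub>0 i / real k) \<longlonglongrightarrow> flow))"
proof -
  let ?I = "{2..n + m}" and ?g = "difference_map n m a" and ?f = "junction_map n m a"
  interpret junction n m a
    by unfold_locales (use assms in auto)
  define B where "B = 2 * real n + 2 * real m + 2"
  have B: "B > 0" by (simp add: B_def)
  have "differences n m (\<lambda>_. 0) \<in> ?I \<rightarrow>\<^sub>E UNIV"
    by (auto simp: differences_def)
  from krylov_bogoliubov[OF _ difference_map_continuous this B]
  obtain Q where Q: "kryloff_bogoliuboff_measure ?I ?g (differences n m (\<lambda>_. 0)) Q"
    and box: "AE y in Q. \<forall>j\<in>?I. \<bar>y j\<bar> \<le> B"
    using junction_orbit_bound unfolding B_def by auto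
  have invariant: "prob_space Q" "?g \<in> measurable Q Q" "distr Q Q ?g = Q"
    and Q_sets: "sets Q = sets (borel_RI ?I)"
    using Q by (simp_all add: kryloff_bogoliuboff_measure_def)
  \<comment> \<open>The box bound holds almost surely at time 0, by invariance at each fixed time,
    and by countability at all times together.\<close>
  have orbit_box: "AE y in Q. \<forall>k. \<forall>j\<in>?I. \<bar>(?g ^^ k) y j\<bar> \<le> B"
    unfolding AE_all_countable by (intro allI AE_invariant[OF invariant] box)
  define \<phi> where "\<phi> y = ?f (y(1 := 0)) 1" for y
  \<comment> \<open>Birkhoff's theorem is proved for globally bounded observables only.\<close>
  define \<psi> where "\<psi> y = max (- (B + 2)) (min (B + 2) (\<phi> y))" for y
  have "\<phi> \<in> borel_measurable (borel_RI ?I)"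
    unfolding \<phi>_def
    by (rule continuous_imp_borel_RI_measurable[OF junction_map_continuous_differences[OF road_indices(1)]])
  then have "\<phi> \<in> borel_measurable Q"
    using Q_sets by (simp cong: measurable_cong_sets)
  then have "\<psi> \<in> borel_measurable Q"
    unfolding \<psi>_def by measurable
  moreover have "\<bar>\<psi> y\<bar> \<le> B + 2" for y
    using B by (auto simp: \<psi>_def)
  ultimately have "AE y in Q. convergent (\<lambda>N. (\<Sum>i<N. \<psi> ((?g ^^ i) y)) / real N)"
    by (rule birkhoff_bounded[OF invariant])
  with orbit_box have "AE y in Q. \<exists>flow::real. \<forall>q\<^sub>0. differences n m q\<^sub>0 = y \<longrightarrow>
      (\<forall>i\<in>{1..n + m}. (\<lambda>k. (?f ^^ k) q\<^sub>0 i / real k) \<longlonglongrightarrow> flow)"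
  proof eventually_elim
    fix y
    assume bound: "\<forall>k. \<forall>j\<in>?I. \<bar>(?g ^^ k) y j\<bar> \<le> B"
      and conv: "convergent (\<lambda>N. (\<Sum>i<N. \<psi> ((?g ^^ i) y)) / real N)"
    \<comment> \<open>Inside the box both arguments of the minimum lie between \<open>- B\<close>
      and \<open>B + 1\<close>, so clamping at \<open>B + 2\<close> changes nothing along this
      orbit.\<close>
    have "\<psi> ((?g ^^ k) y) = \<phi> ((?g ^^ k) y)" for k
    proof -
      define z where "z = (?g ^^ k) y"
      have "n \<in> ?I" "n + m \<in> ?I" "2 \<in> ?I"
        using assms(1,2) by auto
      then have "\<bar>z n\<bar> \<le> B" "\<bar>z (n + m)\<bar> \<le> B" "\<bar>z 2\<bar> \<le> B"
        using bound by (simp_all add: z_def)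
      moreover have "\<phi> z = min (a n + (z n / 2 + z (n + m) / 2)) (abar n m a 1 + z 2)"
        using junction_map_entry(1)[of "z(1 := 0)"] assms(1,2) by (simp add: \<phi>_def)
      moreover have "0 \<le> a n" "a n \<le> 1" "0 \<le> abar n m a 1" "abar n m a 1 \<le> 1"
        using assms(3)[OF road_indices(4)] abar_bounds[OF road_indices(1)] by simp_all
      ultimately have "- (B + 2) \<le> \<phi> z \<and> \<phi> z \<le> B + 2"
        using B by linarith
      then show ?thesis
        by (simp add: \<psi>_def z_def)
    qed
    with conv obtain flow
      where flow: "(\<lambda>N. (\<Sum>i<N. \<phi> ((?g ^^ i) y)) / real N) \<longlonglongrightarrow> flow"
      by (auto simp: convergent_def)
    show "\<exists>flow::real. \<forall>q\<^sub>0. differences n m q\<^sub>0 = y \<longrightarrow>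
        (\<forall>i\<in>{1..n + m}. (\<lambda>k. (?f ^^ k) q\<^sub>0 i / real k) \<longlonglongrightarrow> flow)"
    \<comment> \<open>The limit is fixed before the initial state: the averages of
      \<open>\<phi>\<close> involve \<open>y\<close> alone, so all states with these differences
      share it.\<close>
    proof (intro exI[of _ flow] allI impI ballI)
      fix q\<^sub>0 i
      assume y: "differences n m q\<^sub>0 = y" and i: "i \<in> {1..n + m}"
      have first: "(?f ^^ N) q\<^sub>0 1 = (\<Sum>k<N. \<phi> ((?g ^^ k) y)) + q\<^sub>0 1" for N
        using junction_first_orbit[of N q\<^sub>0] by (simp only: y \<phi>_def)
      have near: "\<bar>(?f ^^ N) q\<^sub>0 i - (?f ^^ N) q\<^sub>0 1\<bar> \<le> B" for N
      proof (cases "i = 1")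
        case False
        with i have "i \<in> ?I" by auto
        then have "(?f ^^ N) q\<^sub>0 i - (?f ^^ N) q\<^sub>0 1 = (?g ^^ N) y i"
          using funpow_difference_map[of N q\<^sub>0] y by (simp add: differences_def)
        then show ?thesis
          using bound \<open>i \<in> ?I\<close> by simp
      qed (use B in simp)
      have "\<bar>(?f ^^ N) q\<^sub>0 i - (\<Sum>k<N. \<phi> ((?g ^^ k) y))\<bar> \<le> B + \<bar>q\<^sub>0 1\<bar>" for N
        using near[of N] first[of N] by linarith
      then have "\<forall>\<^sub>F N in sequentially. norm ((?f ^^ N) q\<^sub>0 i / real N -
          (\<Sum>k<N. \<phi> ((?g ^^ k) y)) / real N) \<le> (B + \<bar>q\<^sub>0 1\<bar>) / real N"
        by (intro always_eventually allI)
           (simp add: diff_divide_distrib[symmetric] divide_right_mono)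
      from Lim_null_comparison[OF this lim_const_over_n]
      have "(\<lambda>N. (?f ^^ N) q\<^sub>0 i / real N - (\<Sum>k<N. \<phi> ((?g ^^ k) y)) / real N) \<longlonglongrightarrow> 0" .
      from tendsto_add[OF this flow]
      show "(\<lambda>N. (?f ^^ N) q\<^sub>0 i / real N) \<longlonglongrightarrow> flow"
        by simp
    qed
  qed
  with Q show ?thesis by blast
qed

end
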